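(* The $a,b;q$-numbers $[x]_{a,b;q}$ are continuously strongly log-concave in $x$; that is, for all real numbers $x,y,r,a,b,q$ satisfying $0<q<1$, $0<a<b<1$, and $x\ge y\ge r\ge 0$, we have $$[x]_{a,b;q}\,[y]_{a,b;q}\ \ge\ [x+r]_{a,b;q}\,[y-r]_{a,b;q}.$$
   Context: The $a,b;q$-number of $x$ is defined by $$[x]_{a,b;q}:=\frac{(1-q^x)(1-aq^x)(1-bq)(1-aq/b)}{(1-q)(1-aq)(1-bq^x)(1-aq^x/b)}.$$ A function $g$ of a non-negative real variable is called continuously strongly log-concave if $g(x)g(y)\ge g(x+r)g(y-r)$ for all real $x\ge y\ge r\ge 0$. *)

theory Defs
  imports Complex_Main
begin

definition abq_number :: "real \<Rightarrow> real \<Rightarrow> real \<Rightarrow> real \<Rightarrow> real" where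
  "abq_number a b q x =
     ((1 - q powr x) * (1 - a * q powr x) * (1 - b * q) * (1 - a * q / b)) /
     ((1 - q) * (1 - a * q) * (1 - b * q powr x) * (1 - a * q powr x / b))"

(* A function of a non-negative real variable is represented by a total function on the reals;
   the guards ensure that only its values at non-negative arguments matter. *)
definition continuously_strongly_log_concave :: "(real \<Rightarrow> real) \<Rightarrow> bool" where
  "continuously_strongly_log_concave g \<longleftrightarrow>
     (\<forall>x y r. x \<ge> y \<and> y \<ge> r \<and> r \<ge> 0 \<longrightarrow> g x * g y \<ge> g (x + r) * g (y - r))"

end

theory Submission
  imports Defs
begin

text \<open>
  Put \<open>c = a / b\<close>, so \<open>a = b c\<close>, and \<open>X = q powr x\<close>. Up to a nonnegative constant the number is
  \<open>(1 - X)(1 - b c X) / ((1 - b X)(1 - c X))\<close>. Passing from \<open>(x, y)\<close> to \<open>(x + r, y - r)\<close>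
  keeps the product \<open>p = X Y\<close> and increases the sum \<open>s = X + Y\<close>, so the claim is that the quotient
  \<open>N(s) / D(s)\<close> of two quadratics in \<open>s\<close> is decreasing for \<open>2 sqrt p \<le> s \<le> 1 + p\<close>.
  Since \<open>N = D - (1 - b)(1 - c) L\<close> with \<open>L\<close> affine in \<open>s\<close>, it is enough that \<open>L / D\<close> increases.
  The divided difference \<open>(L(s') D(s) - L(s) D(s')) / (s' - s)\<close> is bilinear and decreasing in
  both arguments, and at \<open>s = s' = 1 + p\<close> it equals \<open>(1 - b c)(1 - b c p)(1 - b p)(1 - c p)\<close>.
\<close>

text \<open>\<open>?G s s'\<close> is the quotient by \<open>s' - s\<close> of
  \<open>L s' * D s - L s * D s'\<close>, for the \<open>L\<close> and \<open>D\<close> of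
  \<open>spread_quotient_le\<close>.\<close>

lemma divided_difference_nonneg:
  fixes b c p s s' :: real
  assumes b: "0 \<le> b" "b \<le> 1" and c: "0 \<le> c" "c \<le> 1" and p: "0 \<le> p" "p \<le> 1"
    and s: "0 \<le> s" "4 * p \<le> s\<^sup>2" "s \<le> s'" "s' \<le> 1 + p"
  shows "0 \<le> (1 + b*c*p) * ((1 + b\<^sup>2*p) * (1 + c\<^sup>2*p)) - p*(1+b)*(1+c) * ((b+c)*(1+b*c*p))
              - b*c*(1+b*c*p)*s*s' + b*c*(p*(1+b)*(1+c))*(s+s')"
    (is "0 \<le> ?G s s'")
proof -
  define l where "l = 1 + b*c*p"
  define m where "m = p*(1+b)*(1+c)"
  have l0: "0 \<le> l" using b c p by (simp add: l_def)
  have bc: "0 \<le> b*c" "b*c \<le> 1" using b c by (auto intro: mult_le_one)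
  \<comment> \<open>The slope of \<open>?G\<close> in either argument is
    \<open>-b*c*(l*u - m)\<close>, with \<open>u\<close> the other one, so this bound gives the
    monotonicity. As \<open>s * (1 + p)\<close> is at least \<open>4 * p\<close>, it reduces to
    \<open>(1+p)*(1+b)*(1+c)\<close> \<le> \<open>4*l\<close>; the gap is affine in
    \<open>p\<close>, and \<open>e\<close> interpolates it between p = 0 and p = 1.\<close>
  have m_le: "m \<le> l * s"
  proof -
    have "s * s \<le> s * (1 + p)" using s by (intro mult_left_mono) auto
    then have "4 * p \<le> s * (1 + p)" using s by (simp add: power2_eq_square)
    then have 1: "l * (4 * p) \<le> l * (s * (1 + p))" using l0 by (rule mult_left_mono)
    have e: "4*l - (1+p)*(1+b)*(1+c) = (1-p)*(4-(1+b)*(1+c)) + 2*p*((1-b)*(1-c))"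
      unfolding l_def by (simp add: algebra_simps)
    have "(1+b)*(1+c) \<le> 2 * 2" using b c by (intro mult_mono) auto
    then have "0 \<le> (1-p)*(4-(1+b)*(1+c)) + 2*p*((1-b)*(1-c))"
      using b c p by (intro add_nonneg_nonneg mult_nonneg_nonneg) auto
    then have "(1+p)*(1+b)*(1+c) \<le> 4*l" using e by linarith
    then have "p*((1+p)*(1+b)*(1+c)) \<le> p*(4*l)" using p by (intro mult_left_mono) auto
    then have "m * (1+p) \<le> (l * s) * (1+p)" using 1 by (simp add: m_def algebra_simps)
    then show ?thesis using p by simp
  qed
  \<comment> \<open>Raise \<open>s\<close> to \<open>1+p\<close> with \<open>s'\<close> fixed, then
    raise \<open>s'\<close>.\<close>
  have "?G s s' = ?G (1+p) (1+p) + b*c*((1+p-s)*(l*s'-m) + (1+p-s')*(l*(1+p)-m))"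
    unfolding l_def m_def by (simp add: algebra_simps power2_eq_square)
  moreover have "?G (1+p) (1+p) = (1-b*c)*(1-b*c*p)*(1-b*p)*(1-c*p)"
    by (simp add: algebra_simps power2_eq_square)
  moreover have "0 \<le> (1-b*c)*(1-b*c*p)*(1-b*p)*(1-c*p)"
    using b c p bc by (intro mult_nonneg_nonneg) (auto intro: mult_le_one)
  moreover have "m \<le> l * s'" "m \<le> l * (1+p)"
    using m_le mult_left_mono[OF s(3) l0] mult_left_mono[OF order_trans[OF s(3,4)] l0]
    by linarith+
  then have "0 \<le> b*c*((1+p-s)*(l*s'-m) + (1+p-s')*(l*(1+p)-m))"
    using b c s by (intro add_nonneg_nonneg mult_nonneg_nonneg) auto
  ultimately show ?thesis by linarith
qed

lemma spread_quotient_le: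
  fixes b c X Y X' Y' :: real
  assumes b: "0 \<le> b" "b < 1" and c: "0 \<le> c" "c < 1"
    and pos: "0 \<le> X" "0 \<le> Y" "0 \<le> X'" "0 \<le> Y'" and le1: "X \<le> 1" "Y \<le> 1" "X' \<le> 1" "Y' \<le> 1"
    and prod: "X' * Y' = X * Y" and sum: "X + Y \<le> X' + Y'"
  defines "f \<equiv> \<lambda>X. (1-X)*(1-b*c*X) / ((1-b*X)*(1-c*X))"
  shows "f X' * f Y' \<le> f X * f Y"
proof -
  define p where "p = X * Y"
  \<comment> \<open>For U V = p, (1 - kU)(1 - kV) = 1 - k(U + V) + k^2 p; take k = 1, bc, b,
    c.\<close>
  define N where "N s = (1 - s + p) * (1 - b*c*s + (b*c)\<^sup>2*p)" for s
  define D where "D s = (1 - b*s + b\<^sup>2*p) * (1 - c*s + c\<^sup>2*p)" for s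
  define L where "L s = (1 + b*c*p) * s - p*(1+b)*(1+c)" for s
  have f_mult: "f U * f V = N (U+V) / D (U+V)" if "U * V = p" for U V
    unfolding f_def N_def D_def that[symmetric] times_divide_times_eq
    by (rule arg_cong2[where f = "(/)"]; simp add: algebra_simps power2_eq_square)
  have lt: "b * U < 1" "c * U < 1" if "0 \<le> U" "U \<le> 1" for U
    using mult_left_le[of U b] mult_left_le[of U c] b c that by linarith+
  have D_pos: "0 < D (U+V)" if "U * V = p" "0 \<le> U" "U \<le> 1" "0 \<le> V" "V \<le> 1" for U V
  proof -
    have "D (U+V) = (1-b*U)*(1-c*U)*((1-b*V)*(1-c*V))"
      unfolding D_def that(1)[symmetric] by (simp add: algebra_simps power2_eq_square)
    then show ?thesis using lt that by simp
  qed
  define s where "s = X + Y"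
  define s' where "s' = X' + Y'"
  have Ds: "0 < D s" "0 < D s'"
    using D_pos pos le1 prod by (auto simp: s_def s'_def p_def)
  \<comment> \<open>Both quadratics have leading coefficient \<open>b*c\<close>, and they coincide
    when b = 1 or c = 1.\<close>
  have NL: "N t = D t - (1-b)*(1-c) * L t" for t
    unfolding N_def D_def L_def by (simp add: algebra_simps power2_eq_square)
  define G where "G = (1 + b*c*p) * ((1 + b\<^sup>2*p) * (1 + c\<^sup>2*p)) - p*(1+b)*(1+c) * ((b+c)*(1+b*c*p))
              - b*c*(1+b*c*p)*s*s' + b*c*(p*(1+b)*(1+c))*(s+s')"
  have "0 \<le> G"
    unfolding G_def
  proof (rule divided_difference_nonneg)
    show "0 \<le> p" "p \<le> 1" using pos le1 by (auto simp: p_def mult_le_one)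
    have "0 \<le> (X - Y)\<^sup>2" by simp
    then show "4 * p \<le> s\<^sup>2" by (simp add: s_def p_def power2_eq_square algebra_simps)
    have "0 \<le> (1 - X') * (1 - Y')" using le1 by simp
    then show "s' \<le> 1 + p" using prod by (simp add: s'_def p_def algebra_simps)
  qed (use b c pos sum in \<open>auto simp: s_def s'_def\<close>)
  have "L s' * D s - L s * D s' = (s' - s) * G"
    unfolding L_def D_def G_def by (simp add: algebra_simps power2_eq_square)
  then have "L s * D s' \<le> L s' * D s"
    using mult_nonneg_nonneg[of "s' - s" G] \<open>0 \<le> G\<close> sum unfolding s_def s'_def by linarith
  then have "(1-b)*(1-c) * (L s * D s') \<le> (1-b)*(1-c) * (L s' * D s)"
    using b c by (intro mult_left_mono) auto
  then have "N s' * D s \<le> N s * D s'"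
    by (simp add: NL algebra_simps)
  then have "N s' / D s' \<le> N s / D s"
    using Ds by (simp add: pos_divide_le_eq pos_le_divide_eq)
  then show ?thesis
    using f_mult[of X Y] f_mult[of X' Y'] prod by (simp add: s_def s'_def p_def)
qed

theorem theorem8:
  fixes a b q :: real
  assumes "0 < q" and "q < 1"
    and "0 < a" and "a < b" and "b < 1"
  shows "continuously_strongly_log_concave (\<lambda>x. abq_number a b q x)"
  unfolding continuously_strongly_log_concave_def
proof (intro allI impI, elim conjE)
  fix x y r :: real
  assume xyr: "y \<le> x" "r \<le> y" "0 \<le> r"
  define c where "c = a / b"
  have c: "0 \<le> c" "c < 1" using assms by (auto simp: c_def)
  define f where "f X = (1-X)*(1-b*c*X) / ((1-b*X)*(1-c*X))" for X
  define K where "K = (1 - b*q) * (1 - a*q/b) / ((1-q) * (1-a*q))"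
  have num: "abq_number a b q z = K * f (q powr z)" for z
    using assms by (simp add: abq_number_def K_def f_def c_def mult_ac)
  define X Y t where "X = q powr x" and "Y = q powr y" and "t = q powr r"
  have le1: "q powr z \<le> 1" if "0 \<le> z" for z
    using assms that by (simp add: powr_le1)
  have t: "0 < t" "t \<le> 1" using assms xyr le1 by (auto simp: t_def)
  \<comment> \<open>Powers of q < 1 reverse the order; \<open>Y\<close> \<le> \<open>t\<close> keeps
    \<open>Y / t\<close> in the unit interval.\<close>
  have XY: "X \<le> Y" "Y \<le> t" "0 < X"
    using assms xyr by (auto simp: X_def Y_def t_def intro: powr_mono')
  have sum: "X + Y \<le> X * t + Y / t"
  proof -
    have "0 \<le> (1 - t) * (Y / t - X)"
    proof (intro mult_nonneg_nonneg)
      have "X * t \<le> Y" using mult_left_le[of t X] XY t by linarith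
      then show "0 \<le> Y / t - X" using t by (simp add: field_simps)
    qed (use t in simp)
    also have "\<dots> = X * t + Y / t - (X + Y)" using t by (simp add: field_simps)
    finally show ?thesis by simp
  qed
  have "f (X * t) * f (Y / t) \<le> f X * f Y"
    unfolding f_def
    by (rule spread_quotient_le)
      (use assms c XY t sum in \<open>auto simp: mult_le_one\<close>)
  \<comment> \<open>Each side carries two factors \<open>K\<close>, hence a nonnegative
    square.\<close>
  then have "(K * K) * (f (X * t) * f (Y / t)) \<le> (K * K) * (f X * f Y)"
    by (intro mult_left_mono) auto
  moreover have "q powr (x + r) = X * t" "q powr (y - r) = Y / t"
    by (simp_all add: X_def Y_def t_def powr_add powr_diff)
  ultimately show "abq_number a b q (x + r) * abq_number a b q (y - r)
      \<le> abq_number a b q x * abq_number a b q y"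
    by (simp add: num X_def Y_def mult_ac)
qed

end
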